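(* For every admissible input $(\{g_1,\dots,g_m\},f)$, i.e. $\{g_1,\dots,g_m\}$ a Gröbner basis (with respect to $\prec$) of the ideal $I_0=(g_1,\dots,g_m)$ of $P$ with $g_i\notin k$ for all $i$, and $f\in P$ with $f\neq 0$, the set returned by the algorithm SimpleSignatureGroebner$(\{g_1,\dots,g_m\},f)$ is a Gröbner basis (with respect to $\prec$) of the ideal $I=(g_1,\dots,g_m,f)$.
   Context: **Setting.** Let $k$ be a field, $P=k[x_1,\dots,x_n]$, $\mathbb{T}$ the monoid of monomials of $P$ with a monomial order $\prec$ (a well-order compatible with multiplication). Put $\mathbb{T}_0=\mathbb{T}\cup\{0\}$ (with $0\cdot t=0$), and extend $\prec$ to $\prec_0$ on $\mathbb{T}_0$ by $0\prec_0 t$ for all $t\in\mathbb{T}$. For $t_1,t_2\in\mathbb{T}_0$, $t_1\mid t_2$ means $t_1t_3=t_2$ for some $t_3\in\mathbb{T}$. For $p\in P\setminus\{0\}$, $\mathrm{HM}(p)\in\mathbb{T}$ and $\mathrm{HC}(p)\in k$ are the highest monomial and its coefficient with respect to $\prec$; $\mathrm{HM}(0)=0\in\mathbb{T}_0$, $\mathrm{HC}(0)=0\in k$. $\mathrm{LCM}$ is the least common multiple in $\mathbb{T}$. Fixed input: $\{g_1,\dots,g_m\}\subset P$ is a Gröbner basis of $I_0=(g_1,\dots,g_m)$, no $g_i$ lies in $k$, and $f\in P$, $f\neq 0$. A Gröbner basis of an ideal is a subset of the ideal (the zero polynomial may be among its elements) such that the highest monomial of every nonzero element of the ideal is divisible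 by the highest monomial of some nonzero element of the subset. **Labeled polynomials.** A labeled polynomial is a pair $h=(\sigma,p)\in\mathbb{T}_0\times P$ such that there is $u\in P$ with $\mathrm{HM}(u)=\sigma$ and $uf\equiv p\pmod{I_0}$. $H$ is the set of all labeled polynomials. Write $\mathrm{HM}(h)=\mathrm{HM}(p)$, $\mathrm{HC}(h)=\mathrm{HC}(p)$, signature $\mathcal{S}(h)=\sigma$, $\mathrm{poly}(h)=p$; for $t\in\mathbb{T}$, $th=(t\sigma,tp)$. **Signature-safe reduction.** If $h_1',h_2\in H$, $t\in\mathbb{T}$ satisfy $\mathcal{S}(h_1')\succ_0\mathcal{S}(th_2)$ and $\mathrm{HM}(h_1')=\mathrm{HM}(th_2)\neq0$, the signature-safe reduction of $h_1'$ by $h_2$ is $h_1=(\mathcal{S}(h_1'),\mathrm{poly}(h_1')+Kt\,\mathrm{poly}(h_2))$, with $K\in k$ chosen so that the highest terms cancel, i.e. $\mathrm{HM}(h_1)\prec_0\mathrm{HM}(h_1')$. **Order.** For $h_1=(\sigma_1,p_1)$, $h_2=(\sigma_2,p_2)$ in $H$: $h_1<_{\mathrm H}h_2$ (equivalently $h_2>_{\mathrm H}h_1$) iff $\mathrm{HM}(p_1)\sigma_2\prec_0\mathrm{HM}(p_2)\sigma_1$. This is a (strict) partial order. **Algorithm SimpleSignatureGroebner$(\{g_1,\dots,g_m\},f)$** (any choice is allowed where several are possible): 1. $R\leftarrow\{(\mathrm{HM}(g_1),0),\dots,(\mathrm{HM}(g_m),0),(0,g_1),\dots,(0,g_m)\}$.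 2. $B\leftarrow\varnothing$. 3. $(\sigma,p')\leftarrow(1,f)$. 4. Do forever: (a) $p\leftarrow$ ReduceCheckingSignatures$(\sigma,p',R)$. (b) $R\leftarrow R\cup\{(\sigma,p)\}$. (c) If $p\neq0$: for every $r\in R$ with $r<_{\mathrm H}(\sigma,p)$ and $\mathrm{HM}(r)\neq0$, add $\frac{\mathrm{LCM}(\mathrm{HM}(r),\mathrm{HM}(p))}{\mathrm{HM}(r)}\,r$ to $B$; then for every $r\in R$ with $r>_{\mathrm H}(\sigma,p)$, add $\frac{\mathrm{LCM}(\mathrm{HM}(r),\mathrm{HM}(p))}{\mathrm{HM}(p)}(\sigma,p)$ to $B$. (d) $B\leftarrow B\setminus\{b\in B\mid\exists r\in R:\ r<_{\mathrm H}b\text{ and }\mathcal{S}(r)\mid\mathcal{S}(b)\}$. (e) If $B\neq\varnothing$: $(\sigma,p')\leftarrow$ an element of $B$ with $\prec$-minimal signature. (f) Else: break. 5. Return $\{\mathrm{poly}(r)\mid r\in R\}$. **ReduceCheckingSignatures$(\sigma,p,R)$:** while there is $r\in R$ with $r>_{\mathrm H}(\sigma,p)$ and $\mathrm{HM}(r)\mid\mathrm{HM}(p)$, replace $p$ by the polynomial of the signature-safe reduction of $(\sigma,p)$ by a $>_{\mathrm H}$-maximal such $r$; then return $p$. *)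

theory Defs
  imports Complex_Main "HOL-Library.Poly_Mapping"
begin

text \<open>
  Monomials are exponent vectors, so their product, quotient and unit are \<open>+\<close>, \<open>-\<close> and \<open>0\<close>.
  The extension of the monomials by a zero element is the option type, with \<open>None\<close> as the zero;
  in particular the monomial 1 is \<open>Some 0\<close> there.
\<close>

type_synonym 'x monomial = "'x \<Rightarrow>\<^sub>0 nat"
type_synonym ('x, 'k) mpoly = "'x monomial \<Rightarrow>\<^sub>0 'k"
type_synonym ('x, 'k) labeled = "'x monomial option \<times> ('x, 'k) mpoly"

definition ideal_span :: "'a::comm_ring_1 set \<Rightarrow> 'a set" where
  "ideal_span = module.span (*)"

lemma module_times: "module ((*) :: 'a::comm_ring_1 \<Rightarrow> 'a \<Rightarrow> 'a)"
  by unfold_locales (simp_all add: algebra_simps)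

definition lcm_monomial :: "'x::finite monomial \<Rightarrow> 'x monomial \<Rightarrow> 'x monomial" where
  "lcm_monomial s t = Abs_poly_mapping (\<lambda>x. max (Poly_Mapping.lookup s x) (Poly_Mapping.lookup t x))"

definition times0 :: "'x monomial option \<Rightarrow> 'x monomial option \<Rightarrow> 'x monomial option"
    (infixl "\<cdot>\<^sub>0" 70) where
  "a \<cdot>\<^sub>0 b = (case (a, b) of (Some s, Some t) \<Rightarrow> Some (s + t) | _ \<Rightarrow> None)"

definition dvd0 :: "'x monomial option \<Rightarrow> 'x monomial option \<Rightarrow> bool" (infix "dvd\<^sub>0" 50) where
  "a dvd\<^sub>0 b \<longleftrightarrow> (\<exists>t. a \<cdot>\<^sub>0 Some t = b)"

abbreviation sig :: "('x, 'k::zero) labeled \<Rightarrow> 'x monomial option" where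
  "sig h \<equiv> fst h"

abbreviation pol :: "('x, 'k::zero) labeled \<Rightarrow> ('x, 'k) mpoly" where
  "pol h \<equiv> snd h"

definition shift :: "'x monomial \<Rightarrow> ('x, 'k::field) labeled \<Rightarrow> ('x, 'k) labeled" where
  "shift t h = (Some t \<cdot>\<^sub>0 sig h, Poly_Mapping.single t 1 * pol h)"

locale monomial_order =
  fixes less :: "'x::finite monomial \<Rightarrow> 'x monomial \<Rightarrow> bool" (infix "\<prec>" 50)
  assumes less_transp: "transp (\<prec>)"
    and less_totalp: "totalp (\<prec>)"
    and less_wfp: "wfp (\<prec>)"
    and less_add: "s \<prec> t \<Longrightarrow> s + u \<prec> t + u"
begin

definition less0 :: "'x monomial option \<Rightarrow> 'x monomial option \<Rightarrow> bool" (infix "\<prec>\<^sub>0" 50) where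
  "a \<prec>\<^sub>0 b \<longleftrightarrow>
     (case b of None \<Rightarrow> False | Some t \<Rightarrow> (case a of None \<Rightarrow> True | Some s \<Rightarrow> s \<prec> t))"

definition HM :: "('x, 'k::field) mpoly \<Rightarrow> 'x monomial option" where
  "HM p = (if p = 0 then None
     else Some (THE t. t \<in> Poly_Mapping.keys p \<and> (\<forall>s\<in>Poly_Mapping.keys p. s \<noteq> t \<longrightarrow> s \<prec> t)))"

definition groebner_basis :: "('x, 'k::field) mpoly set \<Rightarrow> ('x, 'k) mpoly set \<Rightarrow> bool" where
  "groebner_basis S I \<longleftrightarrow>
     S \<subseteq> I \<and> (\<forall>p\<in>I. p \<noteq> 0 \<longrightarrow> (\<exists>g\<in>S. g \<noteq> 0 \<and> HM g dvd\<^sub>0 HM p))"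

definition labeled_polys ::
    "('x, 'k::field) mpoly set \<Rightarrow> ('x, 'k) mpoly \<Rightarrow> ('x, 'k) labeled set" where
  "labeled_polys G f = {(\<sigma>, p). \<exists>u. HM u = \<sigma> \<and> u * f - p \<in> ideal_span G}"

definition less_H :: "('x, 'k::field) labeled \<Rightarrow> ('x, 'k) labeled \<Rightarrow> bool"
    (infix "\<prec>\<^sub>H" 50) where
  "h1 \<prec>\<^sub>H h2 \<longleftrightarrow> HM (pol h1) \<cdot>\<^sub>0 sig h2 \<prec>\<^sub>0 HM (pol h2) \<cdot>\<^sub>0 sig h1"

definition safe_reduction ::
    "('x, 'k::field) mpoly set \<Rightarrow> ('x, 'k) mpoly \<Rightarrow>
     ('x, 'k) labeled \<Rightarrow> ('x, 'k) labeled \<Rightarrow> ('x, 'k) labeled \<Rightarrow> bool" where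
  "safe_reduction G f h1' h2 h1 \<longleftrightarrow>
     h1' \<in> labeled_polys G f \<and> h2 \<in> labeled_polys G f \<and>
     (\<exists>t K. sig (shift t h2) \<prec>\<^sub>0 sig h1' \<and>
            HM (pol h1') = HM (pol (shift t h2)) \<and> HM (pol h1') \<noteq> None \<and>
            h1 = (sig h1', pol h1' + Poly_Mapping.single t K * pol h2) \<and>
            HM (pol h1) \<prec>\<^sub>0 HM (pol h1'))"

definition reducers ::
    "('x, 'k::field) labeled set \<Rightarrow> ('x, 'k) labeled \<Rightarrow> ('x, 'k) labeled set" where
  "reducers R h = {r \<in> R. h \<prec>\<^sub>H r \<and> HM (pol r) dvd\<^sub>0 HM (pol h)}"

text \<open>
  Both loops are nondeterministic, so they are given as big-step input/output relations; the last
  argument is the returned value. Divergent runs are not related to any value.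
\<close>

inductive reduce_checking_signatures ::
    "('x, 'k::field) mpoly set \<Rightarrow> ('x, 'k) mpoly \<Rightarrow> ('x, 'k) labeled set \<Rightarrow>
     'x monomial option \<Rightarrow> ('x, 'k) mpoly \<Rightarrow> ('x, 'k) mpoly \<Rightarrow> bool"
  for G f R \<sigma> where
  stop: "reducers R (\<sigma>, p) = {} \<Longrightarrow> reduce_checking_signatures G f R \<sigma> p p"
| step: "r \<in> reducers R (\<sigma>, p) \<Longrightarrow> \<forall>r'\<in>reducers R (\<sigma>, p). \<not> r \<prec>\<^sub>H r' \<Longrightarrow>
    safe_reduction G f (\<sigma>, p) r (\<sigma>, p1) \<Longrightarrow>
    reduce_checking_signatures G f R \<sigma> p1 q \<Longrightarrow>
    reduce_checking_signatures G f R \<sigma> p q"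

text \<open>
  The condition \<open>HM (pol r) = Some s\<close> expresses that \<open>HM (pol r)\<close> is nonzero; in the second set
  this already follows from \<open>h \<prec>\<^sub>H r\<close>. Both sets are empty if \<open>pol h = 0\<close>.
\<close>

definition new_pairs ::
    "('x, 'k::field) labeled set \<Rightarrow> ('x, 'k) labeled \<Rightarrow> ('x, 'k) labeled set" where
  "new_pairs R h =
     {shift (lcm_monomial s t - s) r | r s t.
        r \<in> R \<and> r \<prec>\<^sub>H h \<and> HM (pol r) = Some s \<and> HM (pol h) = Some t} \<union>
     {shift (lcm_monomial s t - t) h | r s t.
        r \<in> R \<and> h \<prec>\<^sub>H r \<and> HM (pol r) = Some s \<and> HM (pol h) = Some t}"

definition prune ::
    "('x, 'k::field) labeled set \<Rightarrow> ('x, 'k) labeled set \<Rightarrow> ('x, 'k) labeled set" where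
  "prune R B = B - {b \<in> B. \<exists>r\<in>R. r \<prec>\<^sub>H b \<and> sig r dvd\<^sub>0 sig b}"

inductive main_loop ::
    "('x, 'k::field) mpoly set \<Rightarrow> ('x, 'k) mpoly \<Rightarrow> ('x, 'k) labeled set \<Rightarrow>
     ('x, 'k) labeled set \<Rightarrow> ('x, 'k) labeled \<Rightarrow> ('x, 'k) mpoly set \<Rightarrow> bool"
  for G f where
  break: "reduce_checking_signatures G f R \<sigma> p' p \<Longrightarrow>
    R' = insert (\<sigma>, p) R \<Longrightarrow> B' = prune R' (B \<union> new_pairs R' (\<sigma>, p)) \<Longrightarrow>
    B' = {} \<Longrightarrow>
    main_loop G f R B (\<sigma>, p') (pol ` R')"
| continue: "reduce_checking_signatures G f R \<sigma> p' p \<Longrightarrow>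
    R' = insert (\<sigma>, p) R \<Longrightarrow> B' = prune R' (B \<union> new_pairs R' (\<sigma>, p)) \<Longrightarrow>
    b \<in> B' \<Longrightarrow> \<forall>b'\<in>B'. \<not> sig b' \<prec>\<^sub>0 sig b \<Longrightarrow>
    main_loop G f R' B' b S \<Longrightarrow>
    main_loop G f R B (\<sigma>, p') S"

definition simple_signature_groebner ::
    "('x, 'k::field) mpoly set \<Rightarrow> ('x, 'k) mpoly \<Rightarrow> ('x, 'k) mpoly set \<Rightarrow> bool" where
  "simple_signature_groebner G f S \<longleftrightarrow>
     main_loop G f ((\<lambda>g. (HM g, 0)) ` G \<union> (\<lambda>g. (None, g)) ` G) {} (Some 0, f) S"

end

end

theory Submission
  imports Defs
begin

text \<open>
  For a signature \<open>\<tau>\<close>, consider the smallest highest monomial that a labeled polynomial of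
  signature \<open>\<tau>\<close> can have, and call \<open>\<tau>\<close> covered by \<open>R\<close> if some multiple of an element of \<open>R\<close> has
  signature \<open>\<tau>\<close> and attains this minimum. Two labeled polynomials of the same nonzero signature
  differ, up to a constant factor, by one of smaller signature; so if all signatures are covered, descending
  along the signature shows that the highest monomial of every element of the ideal \<open>(G, f)\<close> is
  divisible by one from \<open>R\<close> (\<open>covered_divisor\<close>). The same descent shows that if all signatures
  below that of \<open>h\<close> are covered and \<open>h\<close> does not attain the minimum, then \<open>h\<close> has a signature-safe
  reducer in \<open>R\<close> (\<open>nonminimal_has_reducer\<close>).

  Correctness. The loop keeps the invariant that each pair of elements of \<open>R\<close> is either still
  listed in \<open>B\<close> or resolved: some element of \<open>R\<close> lies below it in the order \<open>\<prec>\<^sub>H\<close> and has a signature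
  that divides its signature. This is exactly the condition under which pruning deletes a pair. When
  \<open>B\<close> is empty, all pairs are resolved, and then all signatures are covered
  (\<open>resolved_imp_covered\<close>). Indeed, let \<open>\<tau>\<close> be a smallest uncovered signature and take, among the
  multiples of elements of \<open>R\<close> with signature \<open>\<tau>\<close>, one \<open>t r\<close> with the smallest highest monomial. It
  has a reducer; the pair of \<open>r\<close> with this reducer divides \<open>t r\<close>, and the element of \<open>R\<close> that
  resolves it has a multiple of signature \<open>\<tau>\<close> with a smaller highest monomial, a contradiction.

  Termination. A reduction strictly lowers the highest monomial. In an infinite run of the main
  loop, let \<open>h\<^sub>i\<close> be the element that round \<open>i\<close> adds to \<open>R\<close>. By Dickson's lemma there are \<open>i < j\<close>
  such that signature and highest monomial of \<open>h\<^sub>i\<close> divide those of \<open>h\<^sub>j\<close>. The pair \<open>b\<close> that was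
  reduced to \<open>h\<^sub>j\<close> survived pruning, so \<open>h\<^sub>i\<close> is not below \<open>b\<close>; since \<open>b\<close> had a reducer, \<open>h\<^sub>j\<close> is
  strictly below \<open>b\<close>. Hence \<open>h\<^sub>j\<close> is strictly below \<open>h\<^sub>i\<close>, and \<open>h\<^sub>i\<close> is a reducer of the reduced
  element \<open>h\<^sub>j\<close>, a contradiction (\<open>no_infinite_run\<close>).
\<close>

section \<open>Monomials\<close>

lemma times0_simps [simp]:
  "Some s \<cdot>\<^sub>0 Some t = Some (s + t)" "None \<cdot>\<^sub>0 a = None" "a \<cdot>\<^sub>0 None = None"
  by (simp_all add: times0_def split: option.splits)

lemma times0_eq_None_iff [simp]: "a \<cdot>\<^sub>0 b = None \<longleftrightarrow> a = None \<or> b = None"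
  by (cases a; cases b) simp_all

lemma dvd0_simps [simp]:
  "Some s dvd\<^sub>0 Some t \<longleftrightarrow> (\<exists>u. t = s + u)" "None dvd\<^sub>0 a \<longleftrightarrow> a = None"
  "Some s dvd\<^sub>0 None \<longleftrightarrow> False"
  by (auto simp: dvd0_def)

lemma monomial_dvdI:
  fixes s t :: "'x monomial"
  assumes "\<And>x. Poly_Mapping.lookup s x \<le> Poly_Mapping.lookup t x"
  shows "t = s + (t - s)"
  using assms by (intro poly_mapping_eqI) (simp add: lookup_add lookup_minus)

lemma lookup_lcm_monomial:
  fixes s t :: "'x::finite monomial"
  shows "Poly_Mapping.lookup (lcm_monomial s t) x
    = max (Poly_Mapping.lookup s x) (Poly_Mapping.lookup t x)"
  unfolding lcm_monomial_def by (subst lookup_Abs_poly_mapping) auto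

lemma lcm_monomial_commute: "lcm_monomial s t = lcm_monomial t s"
  by (simp add: lcm_monomial_def max.commute)

lemma lcm_monomial_factors:
  fixes s t :: "'x::finite monomial"
  shows "lcm_monomial s t = s + (lcm_monomial s t - s)"
    and "lcm_monomial s t = t + (lcm_monomial s t - t)"
  by (rule monomial_dvdI, simp add: lookup_lcm_monomial)+

lemma lcm_monomial_least:
  fixes s t :: "'x::finite monomial"
  assumes "s + a = t + b"
  obtains w where "a = (lcm_monomial s t - s) + w"
proof -
  have le: "lcm_monomial s t - s + (a - (lcm_monomial s t - s)) = a"
  proof (rule monomial_dvdI[symmetric])
    fix x
    have "Poly_Mapping.lookup (s + a) x = Poly_Mapping.lookup (t + b) x"
      using assms by simp
    then show "Poly_Mapping.lookup (lcm_monomial s t - s) x \<le> Poly_Mapping.lookup a x"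
      by (simp add: lookup_add lookup_minus lookup_lcm_monomial)
  qed
  then show ?thesis using that by metis
qed

lemma lookup_single_times:
  fixes p :: "('x, 'k::field) mpoly"
  shows "Poly_Mapping.lookup (Poly_Mapping.single t c * p) (t + s) = c * Poly_Mapping.lookup p s"
  by (simp add: lookup_mult lookup_single when_mult)

lemma keys_single_times:
  fixes p :: "('x, 'k::field) mpoly"
  shows "Poly_Mapping.keys (Poly_Mapping.single t c * p) \<subseteq> (+) t ` Poly_Mapping.keys p"
  using keys_mult[of "Poly_Mapping.single t c" p] by (auto split: if_splits)

section \<open>Dickson's lemma\<close>

text \<open>
  Each next index is one at which the sequence attains its minimum over the remaining tail.
\<close>

lemma nat_seq_mono_subseq:
  fixes s :: "nat \<Rightarrow> nat"
  obtains r :: "nat \<Rightarrow> nat" where "strict_mono r" "mono (s \<circ> r)"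
proof -
  have "\<exists>r. \<forall>n. (\<exists>m. m < r n \<and> (\<forall>k>m. s (r n) \<le> s k)) \<and>
      (r n < r (Suc n) \<and> s (r n) \<le> s (r (Suc n)))"
  proof (rule dependent_nat_choice)
    show "\<exists>x m. m < x \<and> (\<forall>k>m. s x \<le> s k)"
      using ex_has_least_nat[of "\<lambda>k. k > 0" 1 s] by auto
  next
    fix x n :: nat
    assume "\<exists>m. m < x \<and> (\<forall>k>m. s x \<le> s k)"
    then obtain m where m: "m < x" "\<forall>k>m. s x \<le> s k" by blast
    obtain y where "y > x" "\<forall>k>x. s y \<le> s k"
      using ex_has_least_nat[of "\<lambda>k. k > x" "Suc x" s] by auto
    then show "\<exists>y. (\<exists>m. m < y \<and> (\<forall>k>m. s y \<le> s k)) \<and> (x < y \<and> s x \<le> s y)"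
      using m by (intro exI[of _ y]) auto
  qed
  then obtain r where "\<forall>n. r n < r (Suc n) \<and> s (r n) \<le> s (r (Suc n))" by blast
  then have "strict_mono r" "mono (s \<circ> r)"
    by (simp_all add: strict_mono_Suc_iff mono_iff_le_Suc)
  then show ?thesis by (rule that)
qed

text \<open>
  A further coordinate is handled by passing to a subsequence, which keeps the coordinates
  treated before monotone.
\<close>

lemma nat_vector_seq_mono_subseq:
  fixes c :: "nat \<Rightarrow> 'i \<Rightarrow> nat"
  assumes "finite A"
  shows "\<exists>r :: nat \<Rightarrow> nat. strict_mono r \<and> (\<forall>i\<in>A. mono (\<lambda>n. c (r n) i))"
  using assms
proof induction
  case empty
  show ?case by (intro exI[of _ id]) (simp add: strict_mono_def)
next
  case (insert i A)
  then obtain r :: "nat \<Rightarrow> nat" where r: "strict_mono r" "\<forall>j\<in>A. mono (\<lambda>n. c (r n) j)" by blast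
  obtain r' :: "nat \<Rightarrow> nat" where r': "strict_mono r'" "mono ((\<lambda>n. c (r n) i) \<circ> r')"
    by (rule nat_seq_mono_subseq[of "\<lambda>n. c (r n) i"])
  have "strict_mono (r \<circ> r')"
    using r(1) r'(1) by (rule strict_mono_o)
  moreover have "\<forall>j\<in>insert i A. mono (\<lambda>n. c ((r \<circ> r') n) j)"
  proof
    fix j assume "j \<in> insert i A"
    then consider "j = i" | "j \<in> A" by blast
    then show "mono (\<lambda>n. c ((r \<circ> r') n) j)"
    proof cases
      case 1
      then show ?thesis using r'(2) by (simp add: comp_def)
    next
      case 2
      then show ?thesis using r(2) strict_mono_mono[OF r'(1)] by (simp add: mono_def)
    qed
  qed
  ultimately show ?case by blast
qed

text \<open>
  The exponent vector is extended by two complementary flags. A pointwise comparison of codes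
  forces the flags to agree, so that zero is compared with zero only.
\<close>

definition exponent_code :: "'x monomial option \<Rightarrow> bool + 'x \<Rightarrow> nat" where
  "exponent_code a i = (case i of Inl b \<Rightarrow> (if (a = None) = b then 1 else 0)
     | Inr x \<Rightarrow> (case a of None \<Rightarrow> 0 | Some s \<Rightarrow> Poly_Mapping.lookup s x))"

lemma exponent_code_dvd0:
  assumes "\<And>i. exponent_code a i \<le> exponent_code b i"
  shows "a dvd\<^sub>0 b"
proof (cases a; cases b)
  fix s t assume *: "a = Some s" "b = Some t"
  then have "t = s + (t - s)"
    using assms[of "Inr x" for x] by (intro monomial_dvdI) (simp add: exponent_code_def)
  then show ?thesis using * by auto
qed (use assms[of "Inl True"] assms[of "Inl False"] in \<open>auto simp: exponent_code_def\<close>)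

lemma dickson_pairs:
  fixes a c :: "nat \<Rightarrow> 'x::finite monomial option"
  obtains i j where "i < j" "a i dvd\<^sub>0 a j" "c i dvd\<^sub>0 c j"
proof -
  define code where "code n = case_sum (exponent_code (a n)) (exponent_code (c n))" for n
  obtain r :: "nat \<Rightarrow> nat" where r: "strict_mono r" "\<forall>i\<in>UNIV. mono (\<lambda>n. code (r n) i)"
    using nat_vector_seq_mono_subseq[of UNIV code] by auto
  have le: "code (r 0) i \<le> code (r 1) i" for i
    using r(2) by (auto simp: mono_def)
  have "a (r 0) dvd\<^sub>0 a (r 1)"
    by (rule exponent_code_dvd0) (use le[of "Inl i" for i] in \<open>simp add: code_def\<close>)
  moreover have "c (r 0) dvd\<^sub>0 c (r 1)"
    by (rule exponent_code_dvd0) (use le[of "Inr i" for i] in \<open>simp add: code_def\<close>)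
  moreover have "r 0 < r 1"
    using r(1) by (simp add: strict_mono_def)
  ultimately show ?thesis using that by blast
qed

section \<open>Highest monomials\<close>

context monomial_order
begin

lemma less_trans: "s \<prec> t \<Longrightarrow> t \<prec> u \<Longrightarrow> s \<prec> u"
  using less_transp by (rule transpD)

lemma less_irrefl [simp]: "\<not> s \<prec> s"
  using less_wfp by (simp add: wfp_imp_irreflp irreflpD)

lemma less_asymp: "asymp (\<prec>)"
  using less_trans less_irrefl by (intro asympI) blast

lemma less_linear: "s \<prec> t \<or> s = t \<or> t \<prec> s"
  using less_totalp by (auto simp: totalp_on_def)

lemma less_add_iff [simp]: "s + u \<prec> t + u \<longleftrightarrow> s \<prec> t"
  using less_add less_linear less_trans less_irrefl by metis

lemma less_add_iff_left [simp]: "u + s \<prec> u + t \<longleftrightarrow> s \<prec> t"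
  using less_add_iff[of s u t] by (simp add: add.commute)

lemma less0_simps [simp]:
  "\<not> a \<prec>\<^sub>0 None" "None \<prec>\<^sub>0 Some t" "Some s \<prec>\<^sub>0 Some t \<longleftrightarrow> s \<prec> t"
  by (simp_all add: less0_def)

lemma None_less0_iff [simp]: "None \<prec>\<^sub>0 a \<longleftrightarrow> a \<noteq> None"
  by (cases a) simp_all

lemma less0_irrefl [simp]: "\<not> a \<prec>\<^sub>0 a"
  by (cases a) simp_all

lemma less0_trans: "a \<prec>\<^sub>0 b \<Longrightarrow> b \<prec>\<^sub>0 c \<Longrightarrow> a \<prec>\<^sub>0 c"
  by (cases a; cases b; cases c) (auto intro: less_trans)

lemma less0_linear: "a \<prec>\<^sub>0 b \<or> a = b \<or> b \<prec>\<^sub>0 a"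
  using less_linear by (cases a; cases b) auto

lemma less0_wfp: "wfp (\<prec>\<^sub>0)"
proof (rule wfpUNIVI)
  fix P :: "'x monomial option \<Rightarrow> bool" and a
  assume step: "\<forall>a. (\<forall>b. b \<prec>\<^sub>0 a \<longrightarrow> P b) \<longrightarrow> P a"
  then have "P None" using less0_simps(1) by blast
  have "P (Some t)" for t
  proof (induction t rule: wfp_induct_rule[OF less_wfp])
    case (1 t)
    have "P b" if "b \<prec>\<^sub>0 Some t" for b
      using 1 \<open>P None\<close> that by (cases b) auto
    then show ?case using step by blast
  qed
  then show "P a" using \<open>P None\<close> by (cases a) auto
qed

lemma less0_minimal_element:
  assumes "x \<in> A"
  obtains m where "m \<in> A" "\<forall>y\<in>A. \<not> k y \<prec>\<^sub>0 k m"
proof -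
  have "\<exists>m. m \<in> A \<and> (\<forall>y\<in>A. \<not> k y \<prec>\<^sub>0 k m)"
    using assms
  proof (induction "k x" arbitrary: x rule: wfp_induct_rule[OF less0_wfp])
    case 1
    then show ?case by blast
  qed
  then show ?thesis using that by blast
qed

lemma HM_Some_iff:
  "HM p = Some t \<longleftrightarrow>
    t \<in> Poly_Mapping.keys p \<and> (\<forall>s\<in>Poly_Mapping.keys p. s \<noteq> t \<longrightarrow> s \<prec> t)"
proof (cases "p = 0")
  case False
  let ?P = "\<lambda>t. t \<in> Poly_Mapping.keys p \<and> (\<forall>s\<in>Poly_Mapping.keys p. s \<noteq> t \<longrightarrow> s \<prec> t)"
  have "\<exists>m\<in>Poly_Mapping.keys p. \<forall>x\<in>Poly_Mapping.keys p. x \<noteq> m \<longrightarrow> \<not> m \<prec> x"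
    by (rule Finite_Set.bex_max_element)
      (use False less_asymp less_transp in \<open>auto intro: asymp_on_subset transp_on_subset\<close>)
  then have "\<exists>t. ?P t" using less_linear by blast
  moreover have "t = t'" if "?P t" "?P t'" for t t'
    using that asympD[OF less_asymp] by metis
  ultimately have ex1: "\<exists>!t. ?P t" by (rule ex_ex1I)
  have HM: "HM p = Some (THE t. ?P t)" using False by (simp add: HM_def)
  show ?thesis
  proof
    assume "HM p = Some t"
    then have eq: "(THE t. ?P t) = t" using HM by (simp only: option.inject)
    show "?P t" by (rule theI'[OF ex1, unfolded eq])
  next
    assume "?P t"
    then show "HM p = Some t" using the1_equality[OF ex1] HM by (simp only: option.inject)
  qed
qed (simp add: HM_def)

lemma HM_eq_None_iff [simp]: "HM p = None \<longleftrightarrow> p = 0"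
  by (simp add: HM_def)

lemma HM_zero [simp]: "HM 0 = None"
  by simp

lemma HM_less_Some_iff: "HM p \<prec>\<^sub>0 Some t \<longleftrightarrow> (\<forall>s\<in>Poly_Mapping.keys p. s \<prec> t)"
proof (cases "HM p")
  case (Some m)
  then have "m \<in> Poly_Mapping.keys p" "\<forall>s\<in>Poly_Mapping.keys p. s \<noteq> m \<longrightarrow> s \<prec> m"
    by (simp_all add: HM_Some_iff)
  then have "m \<prec> t \<longleftrightarrow> (\<forall>s\<in>Poly_Mapping.keys p. s \<prec> t)"
    by (metis less_trans)
  then show ?thesis using Some by simp
qed auto

lemma HM_add_eq:
  assumes "HM q \<prec>\<^sub>0 HM p"
  shows "HM (p + q) = HM p"
proof -
  obtain t where t: "HM p = Some t" using assms by (cases "HM p") auto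
  then have q: "\<forall>s\<in>Poly_Mapping.keys q. s \<prec> t" and
    p: "t \<in> Poly_Mapping.keys p" "\<forall>s\<in>Poly_Mapping.keys p. s \<noteq> t \<longrightarrow> s \<prec> t"
    using assms HM_less_Some_iff[of q t] HM_Some_iff[of p t] by simp_all
  have "t \<notin> Poly_Mapping.keys q" using q less_irrefl by blast
  then have "t \<in> Poly_Mapping.keys (p + q)"
    using p(1) by (simp add: in_keys_iff lookup_add)
  moreover have "\<forall>s\<in>Poly_Mapping.keys (p + q). s \<noteq> t \<longrightarrow> s \<prec> t"
    using p(2) q keys_add[of p q] by blast
  ultimately show ?thesis by (simp add: t HM_Some_iff)
qed

lemma HM_single_times:
  fixes p :: "('x, 'k::field) mpoly"
  assumes "c \<noteq> 0"
  shows "HM (Poly_Mapping.single t c * p) = Some t \<cdot>\<^sub>0 HM p"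
proof (cases "HM p")
  case (Some m)
  then have m: "m \<in> Poly_Mapping.keys p" "\<forall>s\<in>Poly_Mapping.keys p. s \<noteq> m \<longrightarrow> s \<prec> m"
    by (simp_all add: HM_Some_iff)
  have "HM (Poly_Mapping.single t c * p) = Some (t + m)"
    unfolding HM_Some_iff
  proof
    show "t + m \<in> Poly_Mapping.keys (Poly_Mapping.single t c * p)"
      using m(1) assms by (simp add: in_keys_iff lookup_single_times)
    show "\<forall>s\<in>Poly_Mapping.keys (Poly_Mapping.single t c * p). s \<noteq> t + m \<longrightarrow> s \<prec> t + m"
      using m(2) keys_single_times[of t c p] by fastforce
  qed
  then show ?thesis using Some by simp
qed simp

text \<open>
  Applied to polynomials this gives the coefficient of a signature-safe reduction; applied to
  cofactors of \<open>f\<close> it lowers a signature.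
\<close>

lemma HM_cancel:
  fixes p q :: "('x, 'k::field) mpoly"
  assumes "HM p = Some t \<cdot>\<^sub>0 HM q" "p \<noteq> 0"
  obtains K where "K \<noteq> 0" "HM (p + Poly_Mapping.single t K * q) \<prec>\<^sub>0 HM p"
proof -
  obtain m where m: "HM q = Some m" using assms by (cases "HM q") auto
  define K where "K = - (Poly_Mapping.lookup p (t + m) / Poly_Mapping.lookup q m)"
  have p: "HM p = Some (t + m)" using assms m by simp
  have nz: "Poly_Mapping.lookup p (t + m) \<noteq> 0" "Poly_Mapping.lookup q m \<noteq> 0"
    using p m by (simp_all add: HM_Some_iff in_keys_iff)
  then have K: "K \<noteq> 0" by (simp add: K_def)
  then have Kq: "HM (Poly_Mapping.single t K * q) = Some (t + m)"
    using m by (simp add: HM_single_times)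
  let ?r = "p + Poly_Mapping.single t K * q"
  have "Poly_Mapping.lookup ?r (t + m) = 0"
    using nz by (simp add: lookup_add lookup_single_times K_def)
  then have "t + m \<notin> Poly_Mapping.keys ?r" by (simp add: in_keys_iff)
  then have "\<forall>s\<in>Poly_Mapping.keys ?r. s \<prec> t + m"
    using p Kq keys_add[of p "Poly_Mapping.single t K * q"] by (auto simp: HM_Some_iff)
  then have "HM ?r \<prec>\<^sub>0 HM p" by (simp add: p HM_less_Some_iff)
  with K show ?thesis by (rule that)
qed

section \<open>Labeled polynomials\<close>

lemma shift_simps [simp]:
  "sig (shift t h) = Some t \<cdot>\<^sub>0 sig h" "HM (pol (shift t h)) = Some t \<cdot>\<^sub>0 HM (pol h)"
  by (simp_all add: shift_def HM_single_times)

lemma labeled_combine: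
  fixes u v p q :: "('x, 'k::field) mpoly"
  assumes "u * f - p \<in> ideal_span G" "v * f - q \<in> ideal_span G"
  shows "(u + c * v) * f - (p + c * q) \<in> ideal_span G"
proof -
  have "(u * f - p) + c * (v * f - q) \<in> ideal_span G"
    using assms unfolding ideal_span_def
    by (intro module.span_add[OF module_times] module.span_scale[OF module_times])
  then show ?thesis by (simp add: algebra_simps)
qed

text \<open>
  A multiple of strictly smaller signature does not disturb the highest monomial of the cofactor
  of \<open>f\<close>; this is why a signature-safe reduction keeps the label correct.
\<close>

lemma labeled_add:
  fixes p q :: "('x, 'k::field) mpoly"
  assumes "(\<sigma>, p) \<in> labeled_polys G f" "(\<tau>, q) \<in> labeled_polys G f" "Some t \<cdot>\<^sub>0 \<tau> \<prec>\<^sub>0 \<sigma>"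
  shows "(\<sigma>, p + Poly_Mapping.single t K * q) \<in> labeled_polys G f"
proof (cases "K = 0")
  case False
  obtain u v where u: "HM u = \<sigma>" "u * f - p \<in> ideal_span G"
    and v: "HM v = \<tau>" "v * f - q \<in> ideal_span G"
    using assms by (auto simp: labeled_polys_def)
  have "HM (u + Poly_Mapping.single t K * v) = \<sigma>"
    using assms(3) False u v by (simp add: HM_add_eq HM_single_times)
  then show ?thesis
    using labeled_combine[OF u(2) v(2)] by (auto simp: labeled_polys_def)
qed (use assms in simp)

lemma labeled_shift:
  assumes "h \<in> labeled_polys G f"
  shows "shift t h \<in> labeled_polys G f"
proof -
  obtain u where u: "HM u = sig h" "u * f - pol h \<in> ideal_span G"
    using assms by (auto simp: labeled_polys_def)
  have "Poly_Mapping.single t 1 * (u * f - pol h) \<in> ideal_span G"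
    using u(2) unfolding ideal_span_def by (rule module.span_scale[OF module_times])
  then have "(Poly_Mapping.single t 1 * u) * f - Poly_Mapping.single t 1 * pol h \<in> ideal_span G"
    by (simp add: algebra_simps)
  moreover have "HM (Poly_Mapping.single t 1 * u) = Some t \<cdot>\<^sub>0 sig h"
    using u by (simp add: HM_single_times)
  ultimately show ?thesis by (auto simp: labeled_polys_def shift_def)
qed

text \<open>
  Subtracting a suitable multiple of \<open>q\<close> cancels the highest terms of the cofactors of \<open>f\<close>, while
  the highest monomial of \<open>p\<close> survives because that of \<open>q\<close> is smaller.
\<close>

lemma labeled_cancel:
  fixes p q :: "('x, 'k::field) mpoly"
  assumes "(Some \<sigma>, p) \<in> labeled_polys G f" "(Some \<sigma>, q) \<in> labeled_polys G f"
    and "HM q \<prec>\<^sub>0 HM p"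
  obtains \<tau> p' where "\<tau> \<prec>\<^sub>0 Some \<sigma>" "(\<tau>, p') \<in> labeled_polys G f" "HM p' = HM p"
proof -
  obtain u v where u: "HM u = Some \<sigma>" "u * f - p \<in> ideal_span G"
    and v: "HM v = Some \<sigma>" "v * f - q \<in> ideal_span G"
    using assms by (auto simp: labeled_polys_def)
  have "HM u = Some 0 \<cdot>\<^sub>0 HM v" "u \<noteq> 0" using u v by auto
  then obtain K where K: "K \<noteq> 0" "HM (u + Poly_Mapping.single 0 K * v) \<prec>\<^sub>0 HM u"
    by (rule HM_cancel)
  have "Some 0 \<cdot>\<^sub>0 HM q = HM q" by (cases "HM q") simp_all
  then have "HM (p + Poly_Mapping.single 0 K * q) = HM p"
    using assms(3) K(1) by (intro HM_add_eq) (simp add: HM_single_times)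
  moreover have "(HM (u + Poly_Mapping.single 0 K * v), p + Poly_Mapping.single 0 K * q)
      \<in> labeled_polys G f"
    using labeled_combine[OF u(2) v(2)] by (auto simp: labeled_polys_def)
  ultimately show ?thesis using that K(2) u(1) by metis
qed

section \<open>The order on labeled polynomials and reducers\<close>

lemma times0_less_iff [simp]: "a \<cdot>\<^sub>0 Some s \<prec>\<^sub>0 b \<cdot>\<^sub>0 Some s \<longleftrightarrow> a \<prec>\<^sub>0 b"
  by (cases a; cases b) simp_all

lemma less_H_irrefl [simp]: "\<not> h \<prec>\<^sub>H h"
  by (simp add: less_H_def)

lemma less_H_nonzero: "h \<prec>\<^sub>H k \<Longrightarrow> sig h \<noteq> None \<and> pol k \<noteq> 0"
  by (cases "sig h"; cases "HM (pol k)") (auto simp: less_H_def)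

lemma less_H_same_sig:
  assumes "sig h = Some a" "sig k = Some a"
  shows "h \<prec>\<^sub>H k \<longleftrightarrow> HM (pol h) \<prec>\<^sub>0 HM (pol k)"
  using assms by (simp add: less_H_def)

text \<open>
  The order compares the quotients of highest monomial and signature, and a shift preserves this
  quotient.
\<close>

lemma less_H_shift_iff [simp]: "shift t h \<prec>\<^sub>H k \<longleftrightarrow> h \<prec>\<^sub>H k" "k \<prec>\<^sub>H shift t h \<longleftrightarrow> k \<prec>\<^sub>H h"
proof -
  have "Some t \<cdot>\<^sub>0 a \<cdot>\<^sub>0 b \<prec>\<^sub>0 c \<cdot>\<^sub>0 (Some t \<cdot>\<^sub>0 d) \<longleftrightarrow> a \<cdot>\<^sub>0 b \<prec>\<^sub>0 c \<cdot>\<^sub>0 d"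
    and "c \<cdot>\<^sub>0 (Some t \<cdot>\<^sub>0 d) \<prec>\<^sub>0 Some t \<cdot>\<^sub>0 a \<cdot>\<^sub>0 b \<longleftrightarrow> c \<cdot>\<^sub>0 d \<prec>\<^sub>0 a \<cdot>\<^sub>0 b" for a b c d
    by (cases a; cases b; cases c; cases d; simp add: add.assoc add.left_commute[of _ t])+
  then show "shift t h \<prec>\<^sub>H k \<longleftrightarrow> h \<prec>\<^sub>H k" "k \<prec>\<^sub>H shift t h \<longleftrightarrow> k \<prec>\<^sub>H h"
    by (simp_all add: less_H_def)
qed

lemma less_H_trans:
  assumes "h \<prec>\<^sub>H k" "k \<prec>\<^sub>H l"
  shows "h \<prec>\<^sub>H l"
proof -
  obtain s2 a1 where k: "HM (pol k) = Some s2" and h: "sig h = Some a1"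
    using less_H_nonzero[OF assms(1)] by (metis HM_eq_None_iff not_None_eq)
  obtain s3 a2 where l: "HM (pol l) = Some s3" and k': "sig k = Some a2"
    using less_H_nonzero[OF assms(2)] by (metis HM_eq_None_iff not_None_eq)
  show ?thesis
  proof (cases "HM (pol h)"; cases "sig l")
    fix s1 a3 assume hl: "HM (pol h) = Some s1" "sig l = Some a3"
    have "s1 + a2 \<prec> s2 + a1" "s2 + a3 \<prec> s3 + a2"
      using assms by (simp_all add: less_H_def h k k' l hl)
    then have "(s1 + a2) + a3 \<prec> (s2 + a1) + a3" "(s2 + a3) + a1 \<prec> (s3 + a2) + a1"
      by (simp_all only: less_add_iff)
    then have "(s1 + a3) + a2 \<prec> (s3 + a1) + a2"
      using less_trans[of "s1 + a2 + a3" "s2 + a1 + a3" "s3 + a2 + a1"] by (simp only: ac_simps)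
    then show ?thesis by (simp add: less_H_def h l hl)
  qed (simp_all add: less_H_def h l)
qed

text \<open>
  Comparing quotients by \<open>\<prec>\<^sub>H\<close> becomes a comparison of signatures once the candidate is shifted to
  the same highest monomial: reducers are exactly the elements that admit a signature-safe
  reduction.
\<close>

lemma reducers_iff:
  "r \<in> reducers R h \<longleftrightarrow> r \<in> R \<and> pol h \<noteq> 0 \<and>
    (\<exists>t. HM (pol (shift t r)) = HM (pol h) \<and> sig (shift t r) \<prec>\<^sub>0 sig h)"
proof -
  have *: "HM (pol h) \<cdot>\<^sub>0 sig r \<prec>\<^sub>0 HM (pol r) \<cdot>\<^sub>0 sig h \<longleftrightarrow> pol h \<noteq> 0 \<and> Some t \<cdot>\<^sub>0 sig r \<prec>\<^sub>0 sig h"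
    if "Some t \<cdot>\<^sub>0 HM (pol r) = HM (pol h)" for t
  proof (cases "HM (pol r)")
    case None
    then have "pol r = 0" "pol h = 0" using that by (simp_all flip: HM_eq_None_iff)
    then show ?thesis by simp
  next
    case (Some s)
    have "t + s + b \<prec> s + a \<longleftrightarrow> t + b \<prec> a" for a b
      using less_add_iff_left[of s "t + b" a] by (simp add: ac_simps)
    moreover have "HM (pol h) = Some (t + s)" using that Some by simp
    moreover from this have "pol h \<noteq> 0" by auto
    ultimately show ?thesis
      using Some by (cases "sig r"; cases "sig h") simp_all
  qed
  have dvd: "HM (pol r) dvd\<^sub>0 HM (pol h) \<longleftrightarrow> (\<exists>t. Some t \<cdot>\<^sub>0 HM (pol r) = HM (pol h))"
    by (cases "HM (pol r)"; cases "HM (pol h)") (auto simp: add.commute)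
  show ?thesis
    unfolding reducers_def less_H_def mem_Collect_eq dvd shift_simps using * by blast
qed

lemma reducers_mono: "R \<subseteq> R' \<Longrightarrow> reducers R h \<subseteq> reducers R' h"
  by (auto simp: reducers_def)

section \<open>Sufficiency of resolved pairs\<close>

text \<open>
  The second alternative is the pruning criterion for the pair, written with \<open>r1\<close> in place of its
  shift, which occupies the same place in the order \<open>\<prec>\<^sub>H\<close>. With \<open>{}\<close> for \<open>B\<close>, the definition says
  that every pair meets this criterion.
\<close>

definition pairs_resolved ::
    "('x, 'k::field) labeled set \<Rightarrow> ('x, 'k) labeled set \<Rightarrow> bool" where
  "pairs_resolved R B \<longleftrightarrow> (\<forall>r1\<in>R. \<forall>r2\<in>R. \<forall>s t. r1 \<prec>\<^sub>H r2 \<longrightarrow>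
     HM (pol r1) = Some s \<longrightarrow> HM (pol r2) = Some t \<longrightarrow>
     shift (lcm_monomial s t - s) r1 \<in> B \<or>
     (\<exists>r\<in>R. r \<prec>\<^sub>H r1 \<and> sig r dvd\<^sub>0 sig (shift (lcm_monomial s t - s) r1)))"

definition covered ::
    "('x, 'k::field) mpoly set \<Rightarrow> ('x, 'k) mpoly \<Rightarrow> ('x, 'k) labeled set \<Rightarrow> 'x monomial \<Rightarrow> bool"
    where
  "covered G f R \<tau> \<longleftrightarrow> (\<exists>r\<in>R. \<exists>t. sig (shift t r) = Some \<tau> \<and>
     (\<forall>p. (Some \<tau>, p) \<in> labeled_polys G f \<longrightarrow> \<not> HM p \<prec>\<^sub>0 HM (pol (shift t r))))"

text \<open>
  Induction on the signature. If the multiple of \<open>r\<close> that covers \<open>\<sigma>\<close> does not have the highest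
  monomial of \<open>p\<close>, then it has a smaller one, and cancelling the signatures leaves a labeled
  polynomial with the highest monomial of \<open>p\<close> and a smaller signature. At the signature zero, \<open>p\<close>
  lies in the ideal of \<open>G\<close>, and the Groebner basis \<open>G\<close> supplies the divisor.
\<close>

lemma covered_divisor:
  fixes p :: "('x, 'k::field) mpoly"
  assumes gb: "groebner_basis G (ideal_span G)" and base: "(\<lambda>g. (None, g)) ` G \<subseteq> R"
    and R: "R \<subseteq> labeled_polys G f"
    and "(\<sigma>, p) \<in> labeled_polys G f" "p \<noteq> 0"
    and "\<And>\<tau>. \<not> \<sigma> \<prec>\<^sub>0 Some \<tau> \<Longrightarrow> covered G f R \<tau>"
  shows "\<exists>r\<in>R. \<exists>t. HM (pol (shift t r)) = HM p \<and> \<not> \<sigma> \<prec>\<^sub>0 sig (shift t r)"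
  using assms(4-)
proof (induction \<sigma> arbitrary: p rule: wfp_induct_rule[OF less0_wfp])
  case (1 \<sigma>)
  show ?case
  proof (cases \<sigma>)
    case None
    then have "- p \<in> ideal_span G" using 1(2) by (auto simp: labeled_polys_def)
    then have "p \<in> ideal_span G"
      using module.span_neg[OF module_times, of "- p" G] by (simp add: ideal_span_def)
    then obtain g where g: "g \<in> G" "HM g dvd\<^sub>0 HM p"
      using gb 1(3) by (auto simp: groebner_basis_def)
    then obtain t where "HM g \<cdot>\<^sub>0 Some t = HM p" by (auto simp: dvd0_def)
    then have "Some t \<cdot>\<^sub>0 HM g = HM p" by (cases "HM g") (simp_all add: add.commute)
    moreover have "(None, g) \<in> R" using g(1) base by blast
    ultimately show ?thesis by (intro bexI[of _ "(None, g)"] exI[of _ t]) simp_all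
  next
    case (Some s)
    then obtain r t where r: "r \<in> R" "sig (shift t r) = Some s" "\<not> HM p \<prec>\<^sub>0 HM (pol (shift t r))"
      using 1(2) 1(4)[of s] by (auto simp: covered_def)
    show ?thesis
    proof (cases "HM (pol (shift t r)) = HM p")
      case True
      then show ?thesis using r(1,2) Some by (intro bexI[of _ r] exI[of _ t]) simp_all
    next
      case False
      then have "HM (pol (shift t r)) \<prec>\<^sub>0 HM p" using less0_linear r(3) by blast
      moreover have "(Some s, pol (shift t r)) \<in> labeled_polys G f"
        using labeled_shift[of r G f t] r(1,2) R by (metis prod.collapse subsetD)
      ultimately obtain \<tau> p' where \<tau>: "\<tau> \<prec>\<^sub>0 Some s" "(\<tau>, p') \<in> labeled_polys G f" "HM p' = HM p"
        using labeled_cancel 1(2) Some by metis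
      have "p' \<noteq> 0" using \<tau>(3) 1(3) by (metis HM_eq_None_iff)
      moreover have "covered G f R \<rho>" if "\<not> \<tau> \<prec>\<^sub>0 Some \<rho>" for \<rho>
        using 1(4) \<tau>(1) that Some less0_trans by blast
      ultimately obtain r' t' where "r' \<in> R" "HM (pol (shift t' r')) = HM p"
        "\<not> \<tau> \<prec>\<^sub>0 sig (shift t' r')"
        using 1(1)[of \<tau> p'] \<tau> Some by auto
      then show ?thesis using \<tau>(1) Some less0_trans by blast
    qed
  qed
qed

text \<open>
  Cancelling the signature of \<open>h\<close> against the better polynomial \<open>p\<close> gives a polynomial with the
  highest monomial of \<open>h\<close> and a smaller signature. A divisor of this monomial that respects the
  smaller signature is a reducer of \<open>h\<close>.
\<close>

lemma nonminimal_has_reducer: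
  fixes h :: "('x, 'k::field) labeled"
  assumes gb: "groebner_basis G (ideal_span G)" and base: "(\<lambda>g. (None, g)) ` G \<subseteq> R"
    and R: "R \<subseteq> labeled_polys G f"
    and h: "h \<in> labeled_polys G f" "sig h = Some \<sigma>"
    and p: "(Some \<sigma>, p) \<in> labeled_polys G f" "HM p \<prec>\<^sub>0 HM (pol h)"
    and cov: "\<And>\<tau>. \<tau> \<prec> \<sigma> \<Longrightarrow> covered G f R \<tau>"
  shows "reducers R h \<noteq> {}"
proof -
  have "(Some \<sigma>, pol h) \<in> labeled_polys G f" using h by (metis prod.collapse)
  then obtain \<tau> p' where \<tau>: "\<tau> \<prec>\<^sub>0 Some \<sigma>" "(\<tau>, p') \<in> labeled_polys G f" "HM p' = HM (pol h)"
    using labeled_cancel p by metis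
  have "HM (pol h) \<noteq> None" using p(2) by auto
  then have nz: "pol h \<noteq> 0" "p' \<noteq> 0" using \<tau>(3) by (auto simp flip: HM_eq_None_iff)
  have "covered G f R \<rho>" if "\<not> \<tau> \<prec>\<^sub>0 Some \<rho>" for \<rho>
  proof -
    have "Some \<rho> \<prec>\<^sub>0 Some \<sigma>" using that \<tau>(1) less0_linear less0_trans by metis
    then show ?thesis using cov by simp
  qed
  then obtain r t where r: "r \<in> R" "HM (pol (shift t r)) = HM p'" "\<not> \<tau> \<prec>\<^sub>0 sig (shift t r)"
    using covered_divisor[OF gb base R \<tau>(2) nz(2)] by blast
  then have "sig (shift t r) \<prec>\<^sub>0 sig h"
    using \<tau>(1) h(2) less0_linear less0_trans by metis
  then have "r \<in> reducers R h"
    unfolding reducers_iff using r nz \<tau>(3) by auto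
  then show ?thesis by blast
qed

text \<open>
  The element of signature 1 provides, for every \<open>\<tau>\<close>, at least one multiple with signature \<open>\<tau>\<close>.
  The best such multiple \<open>t r1\<close> must be minimal: a reducer \<open>r2\<close> of it would make a pair with \<open>r1\<close>,
  and whatever resolves this pair has a still better multiple.
\<close>

lemma resolved_imp_covered:
  fixes R :: "('x, 'k::field) labeled set"
  assumes gb: "groebner_basis G (ideal_span G)" and base: "(\<lambda>g. (None, g)) ` G \<subseteq> R"
    and R: "R \<subseteq> labeled_polys G f"
    and unit: "(Some 0, q) \<in> R"
    and res: "pairs_resolved R {}"
  shows "covered G f R \<tau>"
proof (induction \<tau> rule: wfp_induct_rule[OF less_wfp])
  case (1 \<tau>)
  define A where "A = {(r, t). r \<in> R \<and> sig (shift t r) = Some \<tau>}"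
  have "((Some 0, q), \<tau>) \<in> A" using unit by (simp add: A_def)
  then obtain m where m: "m \<in> A"
    "\<forall>y\<in>A. \<not> HM (pol (shift (snd y) (fst y))) \<prec>\<^sub>0 HM (pol (shift (snd m) (fst m)))"
    by (rule less0_minimal_element[where k = "\<lambda>y. HM (pol (shift (snd y) (fst y)))"])
  obtain r1 t where m_eq: "m = (r1, t)" by (cases m)
  then have r1: "r1 \<in> R" "sig (shift t r1) = Some \<tau>"
    using m(1) by (simp_all add: A_def)
  \<comment> \<open>At equal signatures, \<open>\<prec>\<^sub>H\<close> compares highest monomials, so the choice of \<open>r1\<close> makes it
     \<open>\<prec>\<^sub>H\<close>-minimal among all elements whose signature divides \<open>\<tau>\<close>.\<close>
  have least: "\<not> r \<prec>\<^sub>H r1" if "r \<in> R" "sig (shift u r) = Some \<tau>" for r u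
  proof -
    have "\<not> HM (pol (shift u r)) \<prec>\<^sub>0 HM (pol (shift t r1))"
      using bspec[OF m(2), of "(r, u)"] that m_eq by (simp add: A_def)
    then have "\<not> shift u r \<prec>\<^sub>H shift t r1"
      using less_H_same_sig[OF that(2) r1(2)] by simp
    then show ?thesis by simp
  qed
  have False if p: "(Some \<tau>, p) \<in> labeled_polys G f" "HM p \<prec>\<^sub>0 HM (pol (shift t r1))" for p
  proof -
    have "shift t r1 \<in> labeled_polys G f" using R r1(1) labeled_shift by blast
    then have "reducers R (shift t r1) \<noteq> {}"
      by (rule nonminimal_has_reducer[OF gb base R _ r1(2) p]) (rule 1)
    then obtain r2 u where r2: "r2 \<in> R" "r1 \<prec>\<^sub>H r2"
      and u: "HM (pol (shift u r2)) = HM (pol (shift t r1))" "pol (shift t r1) \<noteq> 0"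
      by (metis (no_types, lifting) ex_in_conv less_H_shift_iff(1) mem_Collect_eq reducers_def
          reducers_iff)
    obtain s1 where s1: "HM (pol r1) = Some s1"
      using u(2) by (cases "HM (pol r1)") (auto simp: shift_def)
    then obtain s2 where s2: "HM (pol r2) = Some s2" "s1 + t = s2 + u"
      using u(1) by (cases "HM (pol r2)") (auto simp: add.commute)
    \<comment> \<open>\<open>t r1\<close> is a multiple of the pair of \<open>r1\<close> and \<open>r2\<close>, with quotient \<open>w\<close>.\<close>
    obtain w where w: "t = (lcm_monomial s1 s2 - s1) + w"
      using lcm_monomial_least[OF s2(2)] by blast
    obtain r3 v where r3: "r3 \<in> R" "r3 \<prec>\<^sub>H r1"
      and v: "sig r3 \<cdot>\<^sub>0 Some v = Some (lcm_monomial s1 s2 - s1) \<cdot>\<^sub>0 sig r1"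
      using res r1(1) r2 s1 s2(1) unfolding pairs_resolved_def dvd0_def shift_simps by blast
    obtain a1 where a1: "sig r1 = Some a1" using r1(2) by (cases "sig r1") auto
    then obtain a3 where a3: "sig r3 = Some a3" using v by (cases "sig r3") auto
    have "sig (shift (v + w) r3) = Some \<tau>"
      using v r1(2) by (simp add: a1 a3 w ac_simps) (metis add.commute add.left_commute)
    then show False using least r3 by blast
  qed
  then show ?case using r1 unfolding covered_def by blast
qed

text \<open>
  An element of the ideal is a polynomial with some label, since modulo the ideal of \<open>G\<close> it is a
  multiple of \<open>f\<close>.
\<close>

lemma resolved_imp_groebner:
  fixes R :: "('x, 'k::field) labeled set"
  assumes gb: "groebner_basis G (ideal_span G)" and base: "(\<lambda>g. (None, g)) ` G \<subseteq> R"
    and R: "R \<subseteq> labeled_polys G f"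
    and unit: "(Some 0, q) \<in> R"
    and res: "pairs_resolved R {}"
  shows "groebner_basis (pol ` R) (ideal_span (insert f G))"
proof -
  have mem_iff: "p \<in> ideal_span (insert f G) \<longleftrightarrow> (\<exists>\<sigma>. (\<sigma>, p) \<in> labeled_polys G f)"
    for p :: "('x, 'k) mpoly"
  proof -
    have "p - u * f \<in> ideal_span G \<longleftrightarrow> u * f - p \<in> ideal_span G" for u
      using module.span_neg[OF module_times, of "p - u * f" G]
        module.span_neg[OF module_times, of "u * f - p" G] by (auto simp: ideal_span_def)
    then have "p \<in> ideal_span (insert f G) \<longleftrightarrow> (\<exists>u. u * f - p \<in> ideal_span G)"
      by (simp add: ideal_span_def module.span_breakdown_eq[OF module_times])
    then show ?thesis by (simp add: labeled_polys_def)
  qed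
  have "pol ` R \<subseteq> ideal_span (insert f G)"
  proof
    fix p assume "p \<in> pol ` R"
    then obtain \<sigma> where "(\<sigma>, p) \<in> labeled_polys G f" using R by fastforce
    then show "p \<in> ideal_span (insert f G)" unfolding mem_iff by (rule exI)
  qed
  moreover have "\<exists>g\<in>pol ` R. g \<noteq> 0 \<and> HM g dvd\<^sub>0 HM p"
    if p: "p \<in> ideal_span (insert f G)" "p \<noteq> 0" for p
  proof -
    obtain \<sigma> where "(\<sigma>, p) \<in> labeled_polys G f"
      using p(1) mem_iff[of p] by auto
    from covered_divisor[OF gb base R this p(2) resolved_imp_covered[OF assms]]
    obtain r t where r: "r \<in> R" "HM (pol (shift t r)) = HM p" by blast
    have "pol r \<noteq> 0" using r(2) p(2) HM_eq_None_iff[of p] by (metis HM_zero shift_simps(2) times0_simps(3))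
    moreover have "HM (pol r) dvd\<^sub>0 HM p"
      using r(2) unfolding shift_simps by (cases "HM (pol r)"; cases "HM p") (auto simp: add.commute)
    ultimately show ?thesis using r(1) by blast
  qed
  ultimately show ?thesis by (simp add: groebner_basis_def)
qed

section \<open>Signature-safe reduction\<close>

lemma reduction_result:
  assumes "reduce_checking_signatures G f R \<sigma> p q" "(\<sigma>, p) \<in> labeled_polys G f"
  shows "(\<sigma>, q) \<in> labeled_polys G f" "reducers R (\<sigma>, q) = {}"
    "q = p \<or> HM q \<prec>\<^sub>0 HM p"
proof -
  have "(\<sigma>, q) \<in> labeled_polys G f \<and> reducers R (\<sigma>, q) = {} \<and> (q = p \<or> HM q \<prec>\<^sub>0 HM p)"
    using assms
  proof (induction rule: reduce_checking_signatures.induct)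
    case (step r p p1 q)
    obtain t K where K: "sig (shift t r) \<prec>\<^sub>0 \<sigma>" "r \<in> labeled_polys G f"
      "p1 = p + Poly_Mapping.single t K * pol r" "HM p1 \<prec>\<^sub>0 HM p"
      using step(3) by (auto simp: safe_reduction_def)
    have "(\<sigma>, p1) \<in> labeled_polys G f"
      using labeled_add[of \<sigma> p G f "sig r" "pol r" t K] step.prems K by simp
    from step.IH[OF this] show ?case using K(4) less0_trans by blast
  qed simp
  then show "(\<sigma>, q) \<in> labeled_polys G f" "reducers R (\<sigma>, q) = {}" "q = p \<or> HM q \<prec>\<^sub>0 HM p"
    by blast+
qed

lemma reduction_terminates:
  fixes p :: "('x, 'k::field) mpoly"
  assumes "finite R" "R \<subseteq> labeled_polys G f" "(\<sigma>, p) \<in> labeled_polys G f"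
  shows "\<exists>q. reduce_checking_signatures G f R \<sigma> p q"
  using assms(3)
proof (induction "HM p" arbitrary: p rule: wfp_induct_rule[OF less0_wfp])
  case 1
  show ?case
  proof (cases "reducers R (\<sigma>, p) = {}")
    case True
    then show ?thesis using reduce_checking_signatures.stop by blast
  next
    case False
    have "finite (reducers R (\<sigma>, p))" using assms(1) by (simp add: reducers_def)
    then obtain r where r: "r \<in> reducers R (\<sigma>, p)" "\<forall>r'\<in>reducers R (\<sigma>, p). r' \<noteq> r \<longrightarrow> \<not> r \<prec>\<^sub>H r'"
      using Finite_Set.bex_max_element[of "reducers R (\<sigma>, p)" "(\<prec>\<^sub>H)"] False
        less_H_trans less_H_irrefl
      by (metis (no_types, lifting) asymp_onI transp_onI)
    then have max: "\<forall>r'\<in>reducers R (\<sigma>, p). \<not> r \<prec>\<^sub>H r'" using r(2) less_H_irrefl by metis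
    from r(1) obtain t where t: "r \<in> R" "p \<noteq> 0" "HM (pol (shift t r)) = HM p"
      "sig (shift t r) \<prec>\<^sub>0 \<sigma>"
      unfolding reducers_iff by auto
    then have "HM p = Some t \<cdot>\<^sub>0 HM (pol r)" by simp
    then obtain K where K: "HM (p + Poly_Mapping.single t K * pol r) \<prec>\<^sub>0 HM p"
      using HM_cancel t(2) by metis
    let ?p1 = "p + Poly_Mapping.single t K * pol r"
    have rH: "r \<in> labeled_polys G f" using t(1) assms(2) by blast
    then have "(\<sigma>, ?p1) \<in> labeled_polys G f"
      using labeled_add[of \<sigma> p G f "sig r" "pol r" t K] 1(2) t(4) by simp
    then obtain q where "reduce_checking_signatures G f R \<sigma> ?p1 q"
      using 1(1) K by blast
    moreover have "safe_reduction G f (\<sigma>, p) r (\<sigma>, ?p1)"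
      unfolding safe_reduction_def using 1(2) rH t(2-4) K
      by (intro conjI exI[of _ t] exI[of _ K]) simp_all
    ultimately show ?thesis
      using reduce_checking_signatures.step r(1) max by blast
  qed
qed

section \<open>Correctness and termination of the main loop\<close>

text \<open>
  The last condition serves termination: it makes the reduction of a selected pair take at least
  one step.
\<close>

definition loop_invariant ::
    "('x, 'k::field) mpoly set \<Rightarrow> ('x, 'k) mpoly \<Rightarrow> ('x, 'k) labeled set \<Rightarrow>
     ('x, 'k) labeled set \<Rightarrow> bool" where
  "loop_invariant G f R B \<longleftrightarrow>
     finite R \<and> R \<subseteq> labeled_polys G f \<and> B \<subseteq> labeled_polys G f \<and>
     (\<lambda>g. (None, g)) ` G \<subseteq> R \<and> pairs_resolved R B \<and> (\<forall>b\<in>B. reducers R b \<noteq> {})"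

abbreviation next_pairs ::
    "('x, 'k::field) labeled set \<Rightarrow> ('x, 'k) labeled set \<Rightarrow> ('x, 'k) labeled \<Rightarrow> ('x, 'k) labeled set"
    where
  "next_pairs R B h \<equiv> prune (insert h R) (B \<union> new_pairs (insert h R) h)"

text \<open>
  A pair that involves the new element \<open>h\<close> is put on the list, and a pair leaves the list only by
  pruning, which means that it is resolved.
\<close>

lemma pairs_resolved_insert:
  assumes "pairs_resolved R B"
  shows "pairs_resolved (insert h R) (next_pairs R B h)"
  unfolding pairs_resolved_def
proof (intro ballI allI impI)
  fix r1 r2 s t
  assume r: "r1 \<in> insert h R" "r2 \<in> insert h R" "r1 \<prec>\<^sub>H r2"
    and HM: "HM (pol r1) = Some s" "HM (pol r2) = Some t"
  let ?b = "shift (lcm_monomial s t - s) r1"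
  have "?b \<in> B \<union> new_pairs (insert h R) h \<or> (\<exists>r\<in>R. r \<prec>\<^sub>H r1 \<and> sig r dvd\<^sub>0 sig ?b)"
  proof (cases "r1 = h \<or> r2 = h")
    case True
    then have "?b \<in> new_pairs (insert h R) h"
    proof
      assume "r1 = h"
      then show ?thesis
        using r HM unfolding new_pairs_def by (subst lcm_monomial_commute) blast
    next
      assume "r2 = h"
      then show ?thesis using r HM unfolding new_pairs_def by blast
    qed
    then show ?thesis by blast
  next
    case False
    then show ?thesis using r HM assms unfolding pairs_resolved_def by blast
  qed
  then show "?b \<in> next_pairs R B h \<or> (\<exists>r\<in>insert h R. r \<prec>\<^sub>H r1 \<and> sig r dvd\<^sub>0 sig ?b)"
    unfolding prune_def using less_H_shift_iff(2) by blast
qed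

text \<open>
  The member of the pair that is larger in the order \<open>\<prec>\<^sub>H\<close> reduces the shift of the smaller one,
  because the highest monomial of this shift is the least common multiple.
\<close>

lemma new_pair_has_reducer:
  assumes "b \<in> new_pairs R h" "h \<in> R"
  shows "reducers R b \<noteq> {}"
proof -
  obtain r1 r2 s t where r: "r1 \<in> R" "r2 \<in> R" "r1 \<prec>\<^sub>H r2" "HM (pol r1) = Some s"
    "HM (pol r2) = Some t" "b = shift (lcm_monomial s t - s) r1"
    using assms(1) unfolding new_pairs_def
  proof
    assume "b \<in> {shift (lcm_monomial s t - s) r |r s t.
      r \<in> R \<and> r \<prec>\<^sub>H h \<and> HM (pol r) = Some s \<and> HM (pol h) = Some t}"
    then show ?thesis using that assms(2) by blast
  next
    assume "b \<in> {shift (lcm_monomial s t - t) h |r s t.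
      r \<in> R \<and> h \<prec>\<^sub>H r \<and> HM (pol r) = Some s \<and> HM (pol h) = Some t}"
    then obtain r s t where "r \<in> R" "h \<prec>\<^sub>H r" "HM (pol r) = Some s" "HM (pol h) = Some t"
      "b = shift (lcm_monomial s t - t) h" by blast
    then show ?thesis using that[of h r t s] assms(2) by (simp add: lcm_monomial_commute)
  qed
  have "HM (pol b) = Some (lcm_monomial s t)"
    using r(4,6) lcm_monomial_factors(1)[of s t] by (simp add: add.commute)
  then have "HM (pol r2) dvd\<^sub>0 HM (pol b)"
    using r(5) lcm_monomial_factors(2)[of s t] by auto
  then have "r2 \<in> reducers R b" using r by (simp add: reducers_def)
  then show ?thesis by blast
qed

lemma loop_invariant_step:
  assumes inv: "loop_invariant G f R B" and h: "h \<in> labeled_polys G f"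
  shows "loop_invariant G f (insert h R) (next_pairs R B h)"
proof -
  have sub: "next_pairs R B h \<subseteq> B \<union> new_pairs (insert h R) h" by (auto simp: prune_def)
  have "new_pairs (insert h R) h \<subseteq> labeled_polys G f"
    using inv h by (auto simp: new_pairs_def loop_invariant_def intro!: labeled_shift)
  moreover have "reducers (insert h R) b \<noteq> {}" if "b \<in> B \<union> new_pairs (insert h R) h" for b
    using that
  proof
    assume "b \<in> B"
    then show ?thesis
      using inv reducers_mono[OF subset_insertI[of R h], of b] by (auto simp: loop_invariant_def)
  next
    assume "b \<in> new_pairs (insert h R) h"
    then show ?thesis by (rule new_pair_has_reducer) simp
  qed
  ultimately have "next_pairs R B h \<subseteq> labeled_polys G f"
    and "\<forall>b\<in>next_pairs R B h. reducers (insert h R) b \<noteq> {}"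
    using inv sub unfolding loop_invariant_def by (meson le_sup_iff order_trans, meson subsetD)
  then show ?thesis
    using inv h pairs_resolved_insert[of R B h] by (auto simp: loop_invariant_def)
qed

text \<open>
  The assumption on \<open>h\<close> and \<open>R\<close> says that an element of signature 1 is in \<open>R\<close>, or enters it in the
  current round.
\<close>

lemma main_loop_correct:
  assumes gb: "groebner_basis G (ideal_span G)"
    and "main_loop G f R B h S" "loop_invariant G f R B" "h \<in> labeled_polys G f"
    and "sig h = Some 0 \<or> (\<exists>q. (Some 0, q) \<in> R)"
  shows "groebner_basis S (ideal_span (insert f G))"
  using assms(2-)
proof (induction rule: main_loop.induct)
  case (break R \<sigma> p' p R' B' B)
  have "(\<sigma>, p) \<in> labeled_polys G f" using break reduction_result(1) by blast
  then have inv: "loop_invariant G f R' {}"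
    using loop_invariant_step break by metis
  obtain q where "(Some 0, q) \<in> R'" using break by auto
  then show ?case
    using resolved_imp_groebner[OF gb] inv unfolding loop_invariant_def by blast
next
  case (continue R \<sigma> p' p R' B' B b S)
  have "(\<sigma>, p) \<in> labeled_polys G f" using continue reduction_result(1) by blast
  then have inv: "loop_invariant G f R' B'"
    using loop_invariant_step continue by metis
  moreover have "b \<in> labeled_polys G f"
    using inv continue(4) by (auto simp: loop_invariant_def)
  moreover have "\<exists>q. (Some 0, q) \<in> R'" using continue by auto
  ultimately show ?case using continue.IH by blast
qed

text \<open>
  Dickson's lemma, applied to the signatures and highest monomials of the elements added to \<open>R\<close>,
  yields an earlier element that would have reduced a later one further.
\<close>

lemma no_infinite_run:
  fixes R B :: "nat \<Rightarrow> ('x, 'k::field) labeled set"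
  assumes inv: "\<And>n. loop_invariant G f (R n) (B n)" "\<And>n. h n \<in> labeled_polys G f"
    and red: "\<And>n. reduce_checking_signatures G f (R n) (sig (h n)) (pol (h n)) (p n)"
    and R: "\<And>n. R (Suc n) = insert (sig (h n), p n) (R n)"
    and B: "\<And>n. B (Suc n) = next_pairs (R n) (B n) (sig (h n), p n)"
    and h: "\<And>n. h (Suc n) \<in> B (Suc n)"
  shows False
proof -
  obtain i j where ij: "i < j" "sig (h i) dvd\<^sub>0 sig (h j)" "HM (p i) dvd\<^sub>0 HM (p j)"
    by (rule dickson_pairs[of "\<lambda>n. sig (h n)" "\<lambda>n. HM (p n)"])
  then obtain k where k: "j = Suc k" by (cases j) auto
  have hB: "h j \<in> B j" using h k by simp
  have "R n \<subseteq> R (Suc n)" for n by (simp only: R subset_insertI)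
  moreover have "Suc i \<le> j" using ij(1) by simp
  ultimately have "R (Suc i) \<subseteq> R j" by (rule lift_Suc_mono_le)
  then have hi: "(sig (h i), p i) \<in> R j" by (simp only: R insert_subset)
  have "B j = prune (R j) (B k \<union> new_pairs (R j) (sig (h k), p k))"
    by (simp only: k B R)
  then have not_less: "\<not> (sig (h i), p i) \<prec>\<^sub>H h j"
    using hB hi ij(2) by (auto simp: prune_def)
  have hj: "reducers (R j) (h j) \<noteq> {}"
    using hB inv(1)[of j] by (simp add: loop_invariant_def)
  then have "sig (h j) \<noteq> None"
    by (auto simp: reducers_def dest: less_H_nonzero)
  then obtain a b where ab: "sig (h i) = Some a" "sig (h j) = Some b"
    using ij(2) by (cases "sig (h i)") auto
  have res: "reducers (R j) (sig (h j), p j) = {}" "p j = pol (h j) \<or> HM (p j) \<prec>\<^sub>0 HM (pol (h j))"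
    using reduction_result[OF red[of j]] inv(2)[of j] by simp_all
  \<comment> \<open>The reduction took a step, so its result lies strictly below the selected \<open>h j\<close>, whereas the
     element from round \<open>i\<close> does not lie below \<open>h j\<close>.\<close>
  then have "HM (p j) \<cdot>\<^sub>0 Some a \<prec>\<^sub>0 HM (pol (h j)) \<cdot>\<^sub>0 Some a" using hj by auto
  moreover have "\<not> HM (p i) \<cdot>\<^sub>0 Some b \<prec>\<^sub>0 HM (pol (h j)) \<cdot>\<^sub>0 Some a"
    using not_less by (simp add: less_H_def ab)
  ultimately have "HM (p j) \<cdot>\<^sub>0 Some a \<prec>\<^sub>0 HM (p i) \<cdot>\<^sub>0 Some b"
    using less0_linear[of "HM (p i) \<cdot>\<^sub>0 Some b" "HM (pol (h j)) \<cdot>\<^sub>0 Some a"]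
    by (metis less0_trans)
  then have "(sig (h i), p i) \<in> reducers (R j) (sig (h j), p j)"
    using hi ij(3) ab by (simp add: reducers_def less_H_def)
  then show False using res(1) by blast
qed

text \<open>
  A state from which no value can be reached has a successor with the same property, so that
  dependent choice would produce an infinite run.
\<close>

lemma main_loop_terminates:
  fixes R B :: "('x, 'k::field) labeled set"
  assumes "loop_invariant G f R B" "h \<in> labeled_polys G f"
  shows "\<exists>S. main_loop G f R B h S"
proof (rule ccontr)
  assume no: "\<not> ?thesis"
  define live where "live = (\<lambda>(R, B, h). loop_invariant G f R B \<and> h \<in> labeled_polys G f \<and>
    (\<nexists>S. main_loop G f R B h S))"
  define next_state where "next_state = (\<lambda>(R, B, h) (R', B', h'). \<exists>p.
    reduce_checking_signatures G f R (sig h) (pol h) p \<and>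
    R' = insert (sig h, p) R \<and> B' = next_pairs R B (sig h, p) \<and> h' \<in> B')"
  have "\<exists>st. \<forall>n. live (st n) \<and> next_state (st n) (st (Suc n))"
  proof (rule dependent_nat_choice)
    show "\<exists>x. live x" using assms no by (intro exI[of _ "(R, B, h)"]) (simp add: live_def)
  next
    fix x assume "live x"
    then obtain R B h where x: "x = (R, B, h)" and inv: "loop_invariant G f R B"
      and h: "h \<in> labeled_polys G f" and no: "\<nexists>S. main_loop G f R B h S"
      by (cases x) (auto simp: live_def)
    obtain p where p: "reduce_checking_signatures G f R (sig h) (pol h) p"
      using reduction_terminates[of R G f "sig h" "pol h"] inv h by (auto simp: loop_invariant_def)
    let ?R = "insert (sig h, p) R" and ?B = "next_pairs R B (sig h, p)"
    have "(sig h, p) \<in> labeled_polys G f" using reduction_result(1)[OF p] h by simp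
    then have inv': "loop_invariant G f ?R ?B" by (rule loop_invariant_step[OF inv])
    have "?B \<noteq> {}" using main_loop.break[OF p refl refl] no by auto
    then obtain b0 where "b0 \<in> ?B" by blast
    then obtain b where b: "b \<in> ?B" "\<forall>b'\<in>?B. \<not> sig b' \<prec>\<^sub>0 sig b"
      by (rule less0_minimal_element[where k = sig])
    then have "\<nexists>S. main_loop G f ?R ?B b S"
      using main_loop.continue[OF p refl refl] no by (metis prod.collapse)
    moreover have "b \<in> labeled_polys G f" using b(1) inv' by (auto simp: loop_invariant_def)
    ultimately have "live (?R, ?B, b)" "next_state x (?R, ?B, b)"
      using inv' b(1) p by (auto simp: live_def next_state_def x)
    then show "\<exists>y. live y \<and> next_state x y" by blast
  qed
  then obtain st where st: "\<And>n. live (st n)" "\<And>n. next_state (st n) (st (Suc n))" by blast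
  define Rs Bs hs where defs: "Rs = fst \<circ> st" "Bs = fst \<circ> snd \<circ> st" "hs = snd \<circ> snd \<circ> st"
  have "\<forall>n. \<exists>p. reduce_checking_signatures G f (Rs n) (sig (hs n)) (pol (hs n)) p \<and>
    Rs (Suc n) = insert (sig (hs n), p) (Rs n) \<and>
    Bs (Suc n) = next_pairs (Rs n) (Bs n) (sig (hs n), p) \<and> hs (Suc n) \<in> Bs (Suc n)"
    using st(2) by (simp add: next_state_def case_prod_beta defs)
  then obtain p where step: "\<forall>n. reduce_checking_signatures G f (Rs n) (sig (hs n)) (pol (hs n)) (p n) \<and>
    Rs (Suc n) = insert (sig (hs n), p n) (Rs n) \<and>
    Bs (Suc n) = next_pairs (Rs n) (Bs n) (sig (hs n), p n) \<and> hs (Suc n) \<in> Bs (Suc n)"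
    by (rule choice[THEN exE])
  have inv: "loop_invariant G f (Rs n) (Bs n)" "hs n \<in> labeled_polys G f" for n
    using st(1)[of n] by (simp_all add: live_def case_prod_beta defs)
  from inv show False
    by (rule no_infinite_run[of G f Rs Bs hs p]) (use step in blast)+
qed

lemma initial_invariant:
  fixes f :: "('x, 'k::field) mpoly"
  assumes "finite G"
  shows "loop_invariant G f ((\<lambda>g. (HM g, 0)) ` G \<union> (\<lambda>g. (None, g)) ` G) {}"
    and "(Some 0, f) \<in> labeled_polys G f"
proof -
  have span: "g \<in> ideal_span G" if "g \<in> G" for g
    using that unfolding ideal_span_def by (rule module.span_base[OF module_times])
  have "(HM g, 0) \<in> labeled_polys G f" if "g \<in> G" for g
  proof -
    have "f * g \<in> ideal_span G"
      using span[OF that] unfolding ideal_span_def by (rule module.span_scale[OF module_times])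
    then show ?thesis
      by (auto simp: labeled_polys_def mult.commute intro!: exI[of _ g])
  qed
  moreover have "(None, g) \<in> labeled_polys G f" if "g \<in> G" for g
  proof -
    have "- g \<in> ideal_span G"
      using span[OF that] unfolding ideal_span_def by (rule module.span_neg[OF module_times])
    then show ?thesis by (simp add: labeled_polys_def)
  qed
  \<comment> \<open>No pairs arise here: the smaller member of a pair has a nonzero signature and a nonzero
     highest monomial, and no initial element has both.\<close>
  moreover have "pairs_resolved ((\<lambda>g. (HM g, 0)) ` G \<union> (\<lambda>g. (None, g)) ` G) {}"
    unfolding pairs_resolved_def
  proof (intro ballI allI impI, goal_cases)
    case (1 r1 r2 s t)
    then show ?case using less_H_nonzero[of r1 r2] by auto
  qed
  ultimately show "loop_invariant G f ((\<lambda>g. (HM g, 0)) ` G \<union> (\<lambda>g. (None, g)) ` G) {}"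
    using assms by (auto simp: loop_invariant_def)
  have "HM (1 :: ('x, 'k) mpoly) = Some 0" by (simp add: HM_Some_iff)
  moreover have "1 * f - f \<in> ideal_span G"
    by (simp add: ideal_span_def module.span_zero[OF module_times])
  ultimately show "(Some 0, f) \<in> labeled_polys G f"
    unfolding labeled_polys_def mem_Collect_eq case_prod_conv by blast
qed

end

theorem theorem21:
  fixes less :: "'x::finite monomial \<Rightarrow> 'x monomial \<Rightarrow> bool"
    and G :: "('x, 'k::field) mpoly set"
    and f :: "('x, 'k) mpoly"
  assumes "monomial_order less"
    and "finite G"
    and "monomial_order.groebner_basis less G (ideal_span G)"
    and "\<forall>g\<in>G. g \<notin> range (Poly_Mapping.single 0)"
    and "f \<noteq> 0"
  shows "(\<exists>S. monomial_order.simple_signature_groebner less G f S) \<and>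
    (\<forall>S. monomial_order.simple_signature_groebner less G f S \<longrightarrow>
      monomial_order.groebner_basis less S (ideal_span (insert f G)))"
proof -
  interpret monomial_order less by fact
  note init = initial_invariant[OF assms(2), of f]
  show ?thesis
    unfolding simple_signature_groebner_def
    using main_loop_terminates[OF init] main_loop_correct[OF assms(3) _ init] by auto
qed

end
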